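(* Let $d\ge 1$, let $\{|j\rangle\}_{j=0}^{d-1}$ be an orthonormal basis of $\mathbb{C}^d$, let $H=\sum_{j=0}^{d-1}E_j|j\rangle\langle j|$ with $E_j\in\mathbb{R}$, let $T=1/\beta>0$, and let $\rho_T=e^{-\beta H}/\mathrm{Tr}[e^{-\beta H}]$. Then every unitary $V$ on $\mathbb{C}^d$ satisfies $$C_r(V\rho_TV^\dagger)\le \log d-S(\rho_T),$$ and the bound is attained: the operator $U=\sum_{j=0}^{d-1}|\phi_j\rangle\langle j|$, where $$|\phi_j\rangle=\mathbb{Z}^j|\phi\rangle,\qquad \mathbb{Z}=\sum_{m=0}^{d-1}e^{2\pi i m/d}|m\rangle\langle m|,\qquad |\phi\rangle=\frac1{\sqrt d}\sum_{i=0}^{d-1}|i\rangle,$$ is unitary and satisfies $C_r(U\rho_TU^\dagger)=\log d-S(\rho_T)$. Consequently $$\max_{V\text{ unitary}}C_r(V\rho_TV^\dagger)=\log d-S(\rho_T).$$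
   Context: Logarithms are to base 2. $S(\rho)=-\mathrm{Tr}(\rho\log\rho)$ is the von Neumann entropy. The relative entropy of coherence of a density matrix $\rho$, with respect to the reference basis $\{|j\rangle\}$ (here the given energy eigenbasis of $H$), is $C_r(\rho)=S(\rho^D)-S(\rho)$, where $\rho^D=\sum_j\langle j|\rho|j\rangle\,|j\rangle\langle j|$ is the diagonal part of $\rho$ in that basis. The Boltzmann constant is set to 1. *)

theory Defs
  imports "Jordan_Normal_Form.Schur_Decomposition" Complex_Main
begin

text \<open>Vectors of \<open>\<complex>\<^sup>d\<close> are elements of \<open>carrier_vec d\<close>, operators are elements of
  \<open>carrier_mat d d\<close>. The library product \<open>v \<bullet>c w\<close> conjugates its second argument, so the
  physicists' \<open>\<langle>v|w\<rangle>\<close> is \<open>w \<bullet>c v\<close>.\<close>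

definition unitary_op :: "nat \<Rightarrow> complex mat \<Rightarrow> bool" where
  "unitary_op d U \<longleftrightarrow> U \<in> carrier_mat d d \<and>
     U * mat_adjoint U = 1\<^sub>m d \<and> mat_adjoint U * U = 1\<^sub>m d"

text \<open>Spanning need not be required: \<open>d\<close> orthonormal vectors of \<open>\<complex>\<^sup>d\<close> form a basis.\<close>

definition orthonormal_basis :: "nat \<Rightarrow> (nat \<Rightarrow> complex vec) \<Rightarrow> bool" where
  "orthonormal_basis d b \<longleftrightarrow> (\<forall>j<d. b j \<in> carrier_vec d) \<and>
     (\<forall>i<d. \<forall>j<d. b j \<bullet>c b i = (if i = j then 1 else 0))"

text \<open>The operator \<open>|v\<rangle>\<langle>w|\<close>.\<close>

definition ket_bra :: "complex vec \<Rightarrow> complex vec \<Rightarrow> complex mat" where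
  "ket_bra v w = mat (dim_vec v) (dim_vec w) (\<lambda>(i, k). v $ i * cnj (w $ k))"

text \<open>The sum \<open>A 0 + \<dots> + A (d - 1)\<close> of \<open>d \<times> d\<close> matrices.\<close>

definition op_sum :: "nat \<Rightarrow> (nat \<Rightarrow> complex mat) \<Rightarrow> complex mat" where
  "op_sum d A = mat d d (\<lambda>(i, k). \<Sum>j<d. A j $$ (i, k))"

definition mat_trace :: "complex mat \<Rightarrow> complex" where
  "mat_trace A = (\<Sum>i<dim_row A. A $$ (i, i))"

text \<open>The exponential series, summed entry by entry.\<close>

definition mat_exp :: "complex mat \<Rightarrow> complex mat" where
  "mat_exp A = mat (dim_row A) (dim_row A) (\<lambda>(i, k). \<Sum>n. (A ^\<^sub>m n) $$ (i, k) / fact n)"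

text \<open>Functional calculus: \<open>f(A) = U diag(f(l\<^sub>0),\<dots>,f(l\<^sub>n\<^sub>-\<^sub>1)) U\<^sup>\<dagger>\<close> for any spectral
  decomposition \<open>A = U diag(l\<^sub>0,\<dots>,l\<^sub>n\<^sub>-\<^sub>1) U\<^sup>\<dagger>\<close> of the Hermitian matrix \<open>A\<close>.
  Lemma \<open>herm_fun_eq\<close> below shows that the choice of decomposition is irrelevant.\<close>

definition herm_fun :: "(real \<Rightarrow> real) \<Rightarrow> complex mat \<Rightarrow> complex mat" where
  "herm_fun f A = (THE B. \<exists>U l. unitary_op (dim_row A) U \<and>
     A = U * mat_diag (dim_row A) (\<lambda>i. complex_of_real (l i)) * mat_adjoint U \<and>
     B = U * mat_diag (dim_row A) (\<lambda>i. complex_of_real (f (l i))) * mat_adjoint U)"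

lemma mat_adjoint_carrier: "U \<in> carrier_mat n n \<Longrightarrow> mat_adjoint U \<in> carrier_mat n n"
  by (auto simp: mat_adjoint_def)

lemma herm_fun_unique:
  assumes U: "unitary_op n U" and V: "unitary_op n V"
    and eq: "U * mat_diag n (\<lambda>i. complex_of_real (l i)) * mat_adjoint U =
             V * mat_diag n (\<lambda>i. complex_of_real (m i)) * mat_adjoint V"
  shows "U * mat_diag n (\<lambda>i. complex_of_real (f (l i))) * mat_adjoint U =
         V * mat_diag n (\<lambda>i. complex_of_real (f (m i))) * mat_adjoint V"
proof -
  let ?D = "\<lambda>g. mat_diag n (\<lambda>i. complex_of_real (g i))"
  let ?U = "mat_adjoint U" and ?V = "mat_adjoint V"
  let ?W = "?V * U"
  have c: "U \<in> carrier_mat n n" "V \<in> carrier_mat n n" "?U \<in> carrier_mat n n" "?V \<in> carrier_mat n n"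
    and D: "\<And>g. ?D g \<in> carrier_mat n n"
    and u: "U * ?U = 1\<^sub>m n" "?U * U = 1\<^sub>m n" "V * ?V = 1\<^sub>m n" "?V * V = 1\<^sub>m n"
    using U V by (auto simp: unitary_op_def mat_adjoint_carrier)
  have M: "A * B \<in> carrier_mat n n" if "A \<in> carrier_mat n n" "B \<in> carrier_mat n n"
    for A B :: "complex mat" using that by auto
  have W: "?W \<in> carrier_mat n n" using c by auto
  have iff: "U * ?D g * ?U = V * ?D h * ?V \<longleftrightarrow> ?W * ?D g = ?D h * ?W" for g h
  proof
    assume "U * ?D g * ?U = V * ?D h * ?V"
    then have "?V * (U * ?D g * ?U) * U = ?V * (V * ?D h * ?V) * U" by simp
    moreover have "?V * (U * ?D g * ?U) * U = ?W * ?D g * (?U * U)"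
      using c D[of g] by (simp add: M assoc_mult_mat[of _ n n _ n _ n])
    moreover have "?V * (V * ?D h * ?V) * U = (?V * V) * ?D h * ?W"
      using c D[of h] by (simp add: M assoc_mult_mat[of _ n n _ n _ n])
    ultimately have "?W * ?D g * 1\<^sub>m n = 1\<^sub>m n * ?D h * ?W"
      by (simp only: u)
    then show "?W * ?D g = ?D h * ?W"
      using M W D by (metis left_mult_one_mat right_mult_one_mat)
  next
    assume "?W * ?D g = ?D h * ?W"
    then have "V * (?W * ?D g) * ?U = V * (?D h * ?W) * ?U" by simp
    moreover have "V * (?W * ?D g) * ?U = (V * ?V) * (U * ?D g * ?U)"
      using c D[of g] by (simp add: M assoc_mult_mat[of _ n n _ n _ n])
    moreover have "V * (?D h * ?W) * ?U = V * ?D h * ?V * (U * ?U)"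
      using c D[of h] by (simp add: M assoc_mult_mat[of _ n n _ n _ n])
    ultimately have "1\<^sub>m n * (U * ?D g * ?U) = V * ?D h * ?V * 1\<^sub>m n"
      by (simp only: u)
    then show "U * ?D g * ?U = V * ?D h * ?V"
      using M c D by (metis left_mult_one_mat right_mult_one_mat)
  qed
  have entry: "?W * ?D g = ?D h * ?W \<longleftrightarrow>
      (\<forall>i<n. \<forall>j<n. ?W $$ (i, j) * complex_of_real (g j) = complex_of_real (h i) * ?W $$ (i, j))"
    for g h
    unfolding mat_diag_mult_left[OF W] mat_diag_mult_right[OF W]
    by (auto simp: mat_eq_iff)
  have "?W * ?D l = ?D m * ?W" using eq iff by simp
  then have *: "?W $$ (i, j) * complex_of_real (l j) = complex_of_real (m i) * ?W $$ (i, j)"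
    if "i < n" "j < n" for i j using that entry by blast
  have "?W $$ (i, j) * complex_of_real (f (l j)) = complex_of_real (f (m i)) * ?W $$ (i, j)"
    if "i < n" "j < n" for i j
    using *[OF that] by (cases "?W $$ (i, j) = 0") auto
  then have "?W * ?D (\<lambda>i. f (l i)) = ?D (\<lambda>i. f (m i)) * ?W"
    unfolding entry by blast
  then show ?thesis unfolding iff .
qed

lemma herm_fun_eq:
  assumes U: "unitary_op n U"
    and A: "A = U * mat_diag n (\<lambda>i. complex_of_real (l i)) * mat_adjoint U"
  shows "herm_fun f A = U * mat_diag n (\<lambda>i. complex_of_real (f (l i))) * mat_adjoint U"
proof -
  have n: "dim_row A = n" using U A by (auto simp: unitary_op_def)
  show ?thesis unfolding herm_fun_def n
  proof (rule the_equality, goal_cases)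
    case 1
    then show ?case using U A by blast
  next
    case (2 B)
    then obtain V m where V: "unitary_op n V"
      and "A = V * mat_diag n (\<lambda>i. complex_of_real (m i)) * mat_adjoint V"
      and B: "B = V * mat_diag n (\<lambda>i. complex_of_real (f (m i))) * mat_adjoint V" by blast
    then show ?case using herm_fun_unique[OF V U] A by simp
  qed
qed

text \<open>Since \<open>log 2 0 = 0\<close> in HOL, an eigenvalue \<open>0\<close> contributes \<open>0\<close>, the usual convention
  \<open>0 log 0 = 0\<close>. The trace is real for Hermitian \<open>\<rho>\<close>; \<open>Re\<close> only changes the type.\<close>

definition vn_entropy :: "complex mat \<Rightarrow> real" where
  "vn_entropy \<rho> = - Re (mat_trace (\<rho> * herm_fun (log 2) \<rho>))"

text \<open>\<open>\<rho>\<^sup>D = \<Sum>\<^sub>j \<langle>j|\<rho>|j\<rangle> |j\<rangle>\<langle>j|\<close> for the reference basis \<open>b\<close>.\<close>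

definition diag_part :: "nat \<Rightarrow> (nat \<Rightarrow> complex vec) \<Rightarrow> complex mat \<Rightarrow> complex mat" where
  "diag_part d b \<rho> = op_sum d (\<lambda>j. ((\<rho> *\<^sub>v b j) \<bullet>c b j) \<cdot>\<^sub>m ket_bra (b j) (b j))"

definition rel_ent_coherence :: "nat \<Rightarrow> (nat \<Rightarrow> complex vec) \<Rightarrow> complex mat \<Rightarrow> real" where
  "rel_ent_coherence d b \<rho> = vn_entropy (diag_part d b \<rho>) - vn_entropy \<rho>"

definition gibbs_state :: "real \<Rightarrow> complex mat \<Rightarrow> complex mat" where
  "gibbs_state \<beta> H =
     (let X = mat_exp (complex_of_real (- \<beta>) \<cdot>\<^sub>m H) in (1 / mat_trace X) \<cdot>\<^sub>m X)"

end

(* All the states involved have the form W diag(p) W* with W unitary, so von Neumann entropies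
   are Shannon entropies and V rho_T V* has the entropy of rho_T. The dephased state is a
   probability distribution q on d points, with entropy at most log d. The unitary U is
   the discrete Fourier transform in the basis b: its entries there have modulus 1 / sqrt d,
   so it makes q uniform. *)
theory Submission
  imports Defs
begin

section \<open>Adjoints and unitary matrices\<close>

lemma mat_adjoint_dim [simp]:
  "dim_row (mat_adjoint A) = dim_col A" "dim_col (mat_adjoint A) = dim_row A"
  by (auto simp: mat_adjoint_def)

lemma mat_adjoint_index [simp]:
  fixes A :: "complex mat"
  shows "i < dim_col A \<Longrightarrow> j < dim_row A \<Longrightarrow> mat_adjoint A $$ (i, j) = cnj (A $$ (j, i))"
  by (simp add: mat_adjoint_def mat_of_rows_index)

lemma mat_adjoint_mult:
  fixes A B :: "complex mat"
  assumes "A \<in> carrier_mat n m" "B \<in> carrier_mat m k"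
  shows "mat_adjoint (A * B) = mat_adjoint B * mat_adjoint A"
  using assms by (intro eq_matI) (auto simp: scalar_prod_def mult.commute intro!: sum.cong)

lemma mat_adjoint_mat_adjoint [simp]:
  fixes A :: "complex mat"
  shows "mat_adjoint (mat_adjoint A) = A"
  by (intro eq_matI) auto

text \<open>A left inverse of a square matrix is also a right inverse, so orthonormality of the
  columns already gives unitarity.\<close>

lemma unitary_opI:
  assumes "U \<in> carrier_mat d d" "mat_adjoint U * U = 1\<^sub>m d"
  shows "unitary_op d U"
  using assms mat_mult_left_right_inverse[OF mat_adjoint_carrier[OF assms(1)] assms(1)]
  by (auto simp: unitary_op_def)

lemma unitary_op_carrier [simp]:
  assumes "unitary_op d U"
  shows "U \<in> carrier_mat d d" "mat_adjoint U \<in> carrier_mat d d"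
  using assms by (auto simp: unitary_op_def mat_adjoint_carrier)

lemma unitary_op_adjoint:
  assumes "unitary_op d U"
  shows "unitary_op d (mat_adjoint U)"
  using assms by (auto simp: unitary_op_def mat_adjoint_carrier)

lemma unitary_op_mult:
  assumes U: "unitary_op d U" and V: "unitary_op d V"
  shows "unitary_op d (U * V)"
proof (rule unitary_opI)
  note c = unitary_op_carrier[OF U] unitary_op_carrier[OF V]
  show "U * V \<in> carrier_mat d d" using c by auto
  have "mat_adjoint (U * V) * (U * V) = mat_adjoint V * (mat_adjoint U * U) * V"
    using c by (simp add: mat_adjoint_mult[of _ d d _ d] assoc_mult_mat[of _ d d _ d _ d])
  also have "\<dots> = 1\<^sub>m d"
    using U V c by (simp add: unitary_op_def)
  finally show "mat_adjoint (U * V) * (U * V) = 1\<^sub>m d" .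
qed

lemma unitary_op_row_norm:
  assumes W: "unitary_op d W" and i: "i < d"
  shows "(\<Sum>j<d. (cmod (W $$ (i, j)))\<^sup>2) = 1"
proof -
  have "(W * mat_adjoint W) $$ (i, i) = 1" using W i by (simp add: unitary_op_def)
  then have "(\<Sum>j<d. W $$ (i, j) * cnj (W $$ (i, j))) = 1"
    using unitary_op_carrier[OF W] i by (auto simp: scalar_prod_def atLeast0LessThan)
  \<comment> \<open>\<open>complex_norm_square\<close> matches
    \<open>complex_of_real ((cmod z)\<^sup>2)\<close>; \<open>of_real_power\<close> is switched off
    because it would move the square outside first.\<close>
  then have "complex_of_real (\<Sum>j<d. (cmod (W $$ (i, j)))\<^sup>2) = 1"
    by (simp add: complex_norm_square del: of_real_power)
  then show ?thesis by (simp only: of_real_eq_1_iff)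
qed

text \<open>Columns of \<open>W\<close> are conjugated rows of its adjoint. Column normalisation is
  what preserves total mass: it gives the trace of a spectral form and the normalisation of the
  dephased distribution.\<close>

lemma unitary_op_col_norm:
  assumes W: "unitary_op d W" and j: "j < d"
  shows "(\<Sum>i<d. (cmod (W $$ (i, j)))\<^sup>2) = 1"
  using unitary_op_row_norm[OF unitary_op_adjoint[OF W] j] unitary_op_carrier[OF W] j by auto

section \<open>Matrices given by a spectral decomposition\<close>

text \<open>Common form of the Hamiltonian, the states and \<open>Z\<close>: for unitary
  \<open>W\<close> the columns are eigenvectors and \<open>c\<close> lists the eigenvalues. They are
  complex because those of \<open>Z\<close> are roots of unity.\<close>

definition spectral_op :: "nat \<Rightarrow> complex mat \<Rightarrow> (nat \<Rightarrow> complex) \<Rightarrow> complex mat" where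
  "spectral_op d W c = W * mat_diag d c * mat_adjoint W"

lemma spectral_op_carrier [simp]:
  "W \<in> carrier_mat d d \<Longrightarrow> spectral_op d W c \<in> carrier_mat d d"
  by (auto simp: spectral_op_def mat_adjoint_carrier intro!: mult_carrier_mat[of _ d d])

lemma spectral_op_dim [simp]:
  "W \<in> carrier_mat d d \<Longrightarrow> dim_row (spectral_op d W c) = d"
  "W \<in> carrier_mat d d \<Longrightarrow> dim_col (spectral_op d W c) = d"
  using spectral_op_carrier carrier_matD by blast+

lemma spectral_op_index:
  assumes "W \<in> carrier_mat d d" "i < d" "k < d"
  shows "spectral_op d W c $$ (i, k) = (\<Sum>j<d. W $$ (i, j) * c j * cnj (W $$ (k, j)))"
  using assms
  by (auto simp: spectral_op_def mat_diag_mult_right[of _ d d] scalar_prod_def atLeast0LessThan)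

lemma spectral_op_cong:
  assumes "\<And>j. j < d \<Longrightarrow> c j = c' j"
  shows "spectral_op d W c = spectral_op d W c'"
proof -
  have "mat_diag d c = mat_diag d c'"
    using assms by (auto simp: mat_diag_def)
  then show ?thesis by (simp add: spectral_op_def)
qed

lemma smult_spectral_op:
  assumes "W \<in> carrier_mat d d"
  shows "a \<cdot>\<^sub>m spectral_op d W c = spectral_op d W (\<lambda>j. a * c j)"
  using assms by (intro eq_matI) (auto simp: spectral_op_index sum_distrib_left ac_simps)

text \<open>Conjugation changes only the frame and keeps the coefficients. For unitary
  \<open>A\<close> and \<open>W\<close> this is the reason why \<open>A\<close> does not change the
  entropy.\<close>

lemma spectral_op_conj:
  assumes A: "A \<in> carrier_mat d d" and W: "W \<in> carrier_mat d d"
  shows "A * spectral_op d W c * mat_adjoint A = spectral_op d (A * W) c"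
  using A W mat_adjoint_carrier[OF A] mat_adjoint_carrier[OF W]
    mat_diag_dim[of d c]
  by (simp add: spectral_op_def mat_adjoint_mult[of _ d d _ d] assoc_mult_mat[of _ d d _ d _ d]
      mult_carrier_mat[of _ d d _ d])

text \<open>The inner factor \<open>mat_adjoint W * W\<close> cancels, so operators with a common
  frame multiply eigenvalue by eigenvalue. Powers, the exponential and the entropy all rest on
  this.\<close>

lemma spectral_op_mult:
  assumes W: "unitary_op d W"
  shows "spectral_op d W f * spectral_op d W g = spectral_op d W (\<lambda>j. f j * g j)"
proof -
  note c = unitary_op_carrier[OF W] mat_diag_dim[of d f] mat_diag_dim[of d g]
  have "spectral_op d W f * spectral_op d W g
      = W * mat_diag d f * (mat_adjoint W * W) * mat_diag d g * mat_adjoint W"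
    using c by (simp add: spectral_op_def assoc_mult_mat[of _ d d _ d _ d]
      mult_carrier_mat[of _ d d _ d])
  also have "mat_adjoint W * W = 1\<^sub>m d" using W by (simp add: unitary_op_def)
  also have "W * mat_diag d f * 1\<^sub>m d * mat_diag d g * mat_adjoint W
      = W * (mat_diag d f * mat_diag d g) * mat_adjoint W"
    using c by (simp add: assoc_mult_mat[of _ d d _ d _ d] mult_carrier_mat[of _ d d _ d]
        left_mult_one_mat[of _ d d] del: mat_diag_diag)
  finally show ?thesis by (simp add: spectral_op_def)
qed

lemma spectral_op_pow:
  assumes W: "unitary_op d W"
  shows "spectral_op d W c ^\<^sub>m n = spectral_op d W (\<lambda>j. c j ^ n)"
proof (induction n)
  case 0
  have "W * mat_diag d (\<lambda>_. 1) * mat_adjoint W = 1\<^sub>m d"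
    using W by (auto simp: unitary_op_def)
  then show ?case
    using carrier_matD[OF unitary_op_carrier(1)[OF W]] by (simp add: spectral_op_def)
next
  case (Suc n)
  then show ?case by (simp add: spectral_op_mult[OF W] mult.commute)
qed

lemma mat_trace_spectral_op:
  assumes W: "unitary_op d W"
  shows "mat_trace (spectral_op d W c) = (\<Sum>j<d. c j)"
proof -
  note c = unitary_op_carrier[OF W]
  have "mat_trace (spectral_op d W c) = (\<Sum>i<d. \<Sum>j<d. c j * (W $$ (i, j) * cnj (W $$ (i, j))))"
    using c by (simp add: mat_trace_def spectral_op_index ac_simps)
  \<comment> \<open>After the sums are swapped, each coefficient is multiplied by the squared norm
    of a column of \<open>W\<close>, which is 1.\<close>
  also have "\<dots> = (\<Sum>j<d. c j * complex_of_real (\<Sum>i<d. (cmod (W $$ (i, j)))\<^sup>2))"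
    by (subst sum.swap) (simp add: sum_distrib_left complex_norm_square del: of_real_power)
  also have "\<dots> = (\<Sum>j<d. c j)"
    using unitary_op_col_norm[OF W] by simp
  finally show ?thesis .
qed

text \<open>Each entry of the matrix series is a fixed finite combination of \<open>d\<close> scalar
  exponential series, so convergence passes through the finite sum.\<close>

lemma mat_exp_spectral_op:
  assumes W: "unitary_op d W"
  shows "mat_exp (spectral_op d W c) = spectral_op d W (\<lambda>j. exp (c j))"
proof (rule eq_matI)
  note c = unitary_op_carrier[OF W]
  fix i k assume "i < dim_row (spectral_op d W (\<lambda>j. exp (c j)))"
    "k < dim_col (spectral_op d W (\<lambda>j. exp (c j)))"
  with c have ik: "i < d" "k < d" by auto
  have "(\<lambda>n. \<Sum>j<d. W $$ (i, j) * (c j ^ n /\<^sub>R fact n) * cnj (W $$ (k, j)))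
      sums (\<Sum>j<d. W $$ (i, j) * exp (c j) * cnj (W $$ (k, j)))"
    by (intro sums_sum sums_mult sums_mult2 exp_converges)
  moreover have "(\<Sum>j<d. W $$ (i, j) * (c j ^ n /\<^sub>R fact n) * cnj (W $$ (k, j)))
      = (spectral_op d W c ^\<^sub>m n) $$ (i, k) / fact n" for n
    using c ik by (simp add: spectral_op_pow[OF W] spectral_op_index sum_divide_distrib
        scaleR_conv_of_real field_simps)
  ultimately have "(\<lambda>n. (spectral_op d W c ^\<^sub>m n) $$ (i, k) / fact n)
      sums (\<Sum>j<d. W $$ (i, j) * exp (c j) * cnj (W $$ (k, j)))" by simp
  then show "mat_exp (spectral_op d W c) $$ (i, k) = spectral_op d W (\<lambda>j. exp (c j)) $$ (i, k)"
    using c ik by (simp add: mat_exp_def spectral_op_index sums_iff)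
qed (use unitary_op_carrier[OF W] in \<open>auto simp: mat_exp_def\<close>)

text \<open>By \<open>herm_fun_eq\<close> the logarithm may be computed in the given frame, even
  when eigenvalues repeat; the entropy then depends only on \<open>p\<close>.\<close>

lemma vn_entropy_spectral_op:
  assumes W: "unitary_op d W"
  shows "vn_entropy (spectral_op d W (\<lambda>j. complex_of_real (p j))) = - (\<Sum>j<d. p j * log 2 (p j))"
proof -
  have "herm_fun (log 2) (spectral_op d W (\<lambda>j. complex_of_real (p j)))
      = spectral_op d W (\<lambda>j. complex_of_real (log 2 (p j)))"
    unfolding spectral_op_def by (rule herm_fun_eq[OF W refl])
  then show ?thesis
    by (simp add: vn_entropy_def spectral_op_mult[OF W] mat_trace_spectral_op[OF W])
qed

section \<open>The reference basis\<close>

text \<open>For an orthonormal basis \<open>b\<close> this is the change of basis from coordinates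
  in \<open>b\<close> to standard coordinates.\<close>

definition col_mat :: "nat \<Rightarrow> (nat \<Rightarrow> complex vec) \<Rightarrow> complex mat" where
  "col_mat d b = mat d d (\<lambda>(i, j). b j $ i)"

lemma col_mat_carrier [simp]: "col_mat d b \<in> carrier_mat d d"
  by (simp add: col_mat_def)

text \<open>The product \<open>mat_adjoint (col_mat d b) * col_mat d b\<close> is the Gram matrix of
  \<open>b\<close>.\<close>

lemma unitary_op_col_mat:
  assumes b: "orthonormal_basis d b"
  shows "unitary_op d (col_mat d b)"
proof (rule unitary_opI)
  have "(mat_adjoint (col_mat d b) * col_mat d b) $$ (i, j) = b j \<bullet>c b i" if "i < d" "j < d" for i j
  proof -
    have "dim_vec (b i) = d" using b that by (simp add: orthonormal_basis_def)
    then show ?thesis using that by (simp add: col_mat_def scalar_prod_def mult.commute)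
  qed
  then show "mat_adjoint (col_mat d b) * col_mat d b = 1\<^sub>m d"
    using b by (intro eq_matI) (auto simp: orthonormal_basis_def col_mat_def)
qed simp

text \<open>The column-times-row expansion of a matrix product; it will turn the sum defining
  \<open>U\<close> into a product.\<close>

lemma op_sum_ket_bra:
  assumes "\<And>j. j < d \<Longrightarrow> v j \<in> carrier_vec d" "\<And>j. j < d \<Longrightarrow> b j \<in> carrier_vec d"
  shows "op_sum d (\<lambda>j. ket_bra (v j) (b j)) = col_mat d v * mat_adjoint (col_mat d b)"
proof -
  have "dim_vec (v j) = d" "dim_vec (b j) = d" if "j < d" for j
    using assms[OF that] by auto
  then show ?thesis
    by (intro eq_matI)
      (auto simp: op_sum_def ket_bra_def col_mat_def scalar_prod_def atLeast0LessThan intro!: sum.cong)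
qed

text \<open>Brings everything diagonal in \<open>b\<close> to spectral form: the Hamiltonian,
  \<open>Z\<close> and the dephased state.\<close>

lemma op_sum_smult_ket_bra:
  assumes "\<And>j. j < d \<Longrightarrow> b j \<in> carrier_vec d"
  shows "op_sum d (\<lambda>j. c j \<cdot>\<^sub>m ket_bra (b j) (b j)) = spectral_op d (col_mat d b) c"
proof (rule eq_matI)
  fix i k assume "i < dim_row (spectral_op d (col_mat d b) c)"
    "k < dim_col (spectral_op d (col_mat d b) c)"
  then have ik: "i < d" "k < d" by auto
  have "dim_vec (b j) = d" if "j < d" for j using assms[OF that] by simp
  then show "op_sum d (\<lambda>j. c j \<cdot>\<^sub>m ket_bra (b j) (b j)) $$ (i, k)
      = spectral_op d (col_mat d b) c $$ (i, k)"
    using ik by (simp add: spectral_op_index op_sum_def ket_bra_def col_mat_def ac_simps)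
qed (auto simp: op_sum_def)

lemma gibbs_state_spectral_op:
  assumes W: "unitary_op d W"
  shows "gibbs_state \<beta> (spectral_op d W (\<lambda>j. complex_of_real (E j)))
    = spectral_op d W (\<lambda>j. complex_of_real (exp (- \<beta> * E j) / (\<Sum>k<d. exp (- \<beta> * E k))))"
  using unitary_op_carrier[OF W]
  by (simp add: gibbs_state_def Let_def smult_spectral_op mat_exp_spectral_op[OF W]
      mat_trace_spectral_op[OF W] exp_of_real flip: of_real_mult of_real_minus exp_of_real)

text \<open>In the coordinates of \<open>b\<close> the frame \<open>col_mat d b * X\<close> becomes
  \<open>X\<close>, and dephasing keeps the diagonal of the resulting matrix: averages of
  \<open>p\<close> weighted by the squared moduli in the rows of \<open>X\<close>.\<close>

lemma diag_part_spectral_op: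
  assumes b: "orthonormal_basis d b" and X: "X \<in> carrier_mat d d"
  shows "diag_part d b (spectral_op d (col_mat d b * X) (\<lambda>k. complex_of_real (p k)))
    = spectral_op d (col_mat d b) (\<lambda>j. complex_of_real (\<Sum>k<d. p k * (cmod (X $$ (j, k)))\<^sup>2))"
proof -
  let ?B = "col_mat d b"
  let ?\<rho> = "spectral_op d (?B * X) (\<lambda>k. complex_of_real (p k))"
  have B: "unitary_op d ?B" using unitary_op_col_mat[OF b] .
  note c = unitary_op_carrier[OF B]
  have bc: "b j \<in> carrier_vec d" if "j < d" for j using b that by (simp add: orthonormal_basis_def)
  have ket_bra_sum: "op_sum d (\<lambda>j. c j \<cdot>\<^sub>m ket_bra (b j) (b j)) = spectral_op d ?B c" for c
    by (intro op_sum_smult_ket_bra bc)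
  have BX: "?B * X \<in> carrier_mat d d" using X by (simp add: mult_carrier_mat[of _ d d])
  have "mat_adjoint ?B * (?B * X) = (mat_adjoint ?B * ?B) * X"
    using c X by (simp add: assoc_mult_mat[of _ d d _ d _ d])
  also have "\<dots> = X" using B X by (simp add: unitary_op_def)
  finally have X_eq: "mat_adjoint ?B * (?B * X) = X" .
  \<comment> \<open>Conjugation by \<open>mat_adjoint ?B\<close> passes to
    \<open>b\<close>-coordinates, cancelling \<open>?B\<close> from the frame.\<close>
  have conj: "mat_adjoint ?B * ?\<rho> * ?B = spectral_op d X (\<lambda>k. complex_of_real (p k))"
    using spectral_op_conj[OF c(2) BX] by (simp add: X_eq)
  have "(?\<rho> *\<^sub>v b j) \<bullet>c b j = complex_of_real (\<Sum>k<d. p k * (cmod (X $$ (j, k)))\<^sup>2)"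
    if j: "j < d" for j
  proof -
    have dim: "dim_vec (b j) = d" using bc[OF j] by simp
    have R: "?\<rho> \<in> carrier_mat d d" using BX by simp
    have colB: "col ?B j = b j" using j dim by (intro eq_vecI) (auto simp: col_mat_def)
    have "(?\<rho> *\<^sub>v b j) \<bullet>c b j = (\<Sum>i<d. cnj (b j $ i) * (?\<rho> *\<^sub>v b j) $ i)"
      using dim by (simp add: scalar_prod_def atLeast0LessThan mult.commute)
    \<comment> \<open>Since \<open>b j\<close> is column \<open>j\<close> of \<open>?B\<close>, the
      expectation value in \<open>b j\<close> is a diagonal entry in
      \<open>b\<close>-coordinates.\<close>
    also have "\<dots> = (mat_adjoint ?B * (?\<rho> * ?B)) $$ (j, j)"
    proof -
      have "col (?\<rho> * ?B) j = ?\<rho> *\<^sub>v b j"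
        using j R colB by (simp add: col_mult2[of _ d d _ d])
      moreover have "row (mat_adjoint ?B) j = vec d (\<lambda>i. cnj (b j $ i))"
        using j by (intro eq_vecI) (auto simp: col_mat_def)
      moreover have "dim_vec (?\<rho> *\<^sub>v b j) = d" using R by auto
      moreover have "j < dim_row (mat_adjoint ?B)" "j < dim_col (?\<rho> * ?B)"
        using j by (auto simp: col_mat_def)
      ultimately show ?thesis by (simp add: scalar_prod_def atLeast0LessThan del: dim_mult_mat_vec)
    qed
    also have "\<dots> = spectral_op d X (\<lambda>k. complex_of_real (p k)) $$ (j, j)"
      using c R by (simp add: conj flip: assoc_mult_mat[of _ d d _ d _ d])
    also have "\<dots> = complex_of_real (\<Sum>k<d. p k * (cmod (X $$ (j, k)))\<^sup>2)"
      using X j by (simp add: spectral_op_index complex_norm_square ac_simps del: of_real_power)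
    finally show ?thesis .
  qed
  then show ?thesis
    unfolding diag_part_def ket_bra_sum by (intro spectral_op_cong) simp
qed

section \<open>Shannon entropy on \<open>d\<close> points is at most \<open>log d\<close>\<close>

lemma shannon_entropy_le:
  fixes q :: "nat \<Rightarrow> real"
  assumes q: "\<And>j. j < d \<Longrightarrow> q j \<ge> 0" and sum: "(\<Sum>j<d. q j) = 1"
  shows "- (\<Sum>j<d. q j * log 2 (q j)) \<le> log 2 (real d)"
proof -
  have d: "d > 0" using sum by (cases d) auto
  \<comment> \<open>Gibbs' inequality term by term: \<open>ln x \<le> x - 1\<close> at
    \<open>x = 1 / (real d * q j)\<close>, the ratio of the uniform weight to \<open>q j\<close>.
    The right-hand sides sum to 0. The ratio is formed only for positive \<open>q j\<close>; at 0
    the claim is \<open>0 \<le> 1 / real d\<close>.\<close>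
  have "- (q j * ln (q j)) - q j * ln (real d) \<le> 1 / real d - q j" if "j < d" for j
  proof (cases "q j = 0")
    case False
    with q[OF that] have pos: "q j > 0" by simp
    have "ln (1 / (real d * q j)) \<le> 1 / (real d * q j) - 1"
      using pos d by (intro ln_le_minus_one) simp
    then have "q j * ln (1 / (real d * q j)) \<le> q j * (1 / (real d * q j) - 1)"
      using pos by (intro mult_left_mono) auto
    then show ?thesis using pos d by (simp add: ln_div ln_mult algebra_simps)
  qed simp
  then have "(\<Sum>j<d. - (q j * ln (q j)) - q j * ln (real d)) \<le> (\<Sum>j<d. 1 / real d - q j)"
    by (intro sum_mono) simp
  also have "\<dots> = 0" using d sum by (simp add: sum_subtractf)
  finally have "- (\<Sum>j<d. q j * ln (q j)) \<le> ln (real d)"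
    using sum by (simp add: sum_subtractf sum_negf flip: sum_distrib_right)
  then have "- (\<Sum>j<d. q j * ln (q j)) / ln 2 \<le> ln (real d) / ln 2"
    by (intro divide_right_mono) auto
  then show ?thesis by (simp add: log_def sum_divide_distrib)
qed

section \<open>The discrete Fourier transform\<close>

text \<open>The unitary Fourier matrix. The power \<open>j\<close> stays outside \<open>exp\<close>
  to match the action of \<open>Z ^\<^sub>m j\<close> on the uniform vector.\<close>

definition dft_mat :: "nat \<Rightarrow> complex mat" where
  "dft_mat d = mat d d (\<lambda>(m, j).
     exp (2 * complex_of_real pi * \<i> * of_nat m / of_nat d) ^ j * complex_of_real (1 / sqrt (real d)))"

lemma dft_mat_carrier [simp]: "dft_mat d \<in> carrier_mat d d"
  by (simp add: dft_mat_def)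

lemma cmod_dft_mat:
  assumes "m < d" "j < d"
  shows "(cmod (dft_mat d $$ (m, j)))\<^sup>2 = 1 / real d"
proof -
  have "cmod (exp (2 * complex_of_real pi * \<i> * of_nat m / of_nat d)) = 1"
    by (simp add: norm_exp_eq_Re)
  then show ?thesis using assms
    by (simp add: dft_mat_def norm_mult norm_power norm_divide power_divide)
qed

text \<open>The inner product of two distinct columns is a geometric sum over a \<open>d\<close>-th
  root of unity other than 1, hence 0.\<close>

lemma unitary_op_dft_mat: "unitary_op d (dft_mat d)"
proof (rule unitary_opI)
  let ?r = "\<lambda>m. exp (2 * complex_of_real pi * \<i> * of_nat m / of_nat d)"
  have "(\<Sum>m<d. cnj (dft_mat d $$ (m, i)) * dft_mat d $$ (m, j)) = (if i = j then 1 else 0)"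
    if ij: "i < d" "j < d" for i j
  proof -
    define z where "z k = cis (2 * pi * real k / real d)" for k
    define w where "w = z j / z i"
    have d: "d > 0" using ij by simp
    \<comment> \<open>This enumeration of the roots of unity yields \<open>w ^ d = 1\<close>, and by
      injectivity \<open>w \<noteq> 1\<close> off the diagonal.\<close>
    have roots: "bij_betw z {..<d} {x. x ^ d = 1}"
      unfolding z_def by (rule bij_betw_roots_unity[OF d])
    have summand: "cnj (dft_mat d $$ (m, i)) * dft_mat d $$ (m, j) = w ^ m / of_nat d" if "m < d" for m
    proof -
      have "?r m = cis (2 * pi * real m / real d)"
        by (simp add: cis_conv_exp ac_simps)
      then have "cnj (?r m ^ i) * ?r m ^ j = w ^ m"
        by (simp add: w_def z_def cis_cnj DeMoivre cis_mult cis_divide power_divide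
            algebra_simps diff_divide_distrib)
      moreover have "complex_of_real (1 / sqrt (real d)) * complex_of_real (1 / sqrt (real d))
          = 1 / of_nat d"
        by (simp flip: of_real_mult)
      ultimately show ?thesis
        using that ij by (simp add: dft_mat_def)
    qed
    have wd: "w ^ d = 1"
      using bij_betwE[OF roots] ij by (simp add: w_def power_divide)
    have w1: "w \<noteq> 1" if "i \<noteq> j"
      using that ij inj_on_eq_iff[OF bij_betw_imp_inj_on[OF roots]] by (auto simp: w_def)
    have "(\<Sum>m<d. cnj (dft_mat d $$ (m, i)) * dft_mat d $$ (m, j)) = (\<Sum>m<d. w ^ m) / of_nat d"
      by (simp add: summand sum_divide_distrib)
    also have "\<dots> = (if i = j then 1 else 0)"
      using w1 wd d by (auto simp: geometric_sum) (simp add: w_def z_def)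
    finally show ?thesis .
  qed
  then show "mat_adjoint (dft_mat d) * dft_mat d = 1\<^sub>m d"
    by (intro eq_matI) (auto simp: scalar_prod_def atLeast0LessThan carrier_matD[OF dft_mat_carrier])
qed simp


section \<open>The coherence bound and its attainment\<close>

theorem mainTheorem1:
  fixes d :: nat and b :: "nat \<Rightarrow> complex vec" and E :: "nat \<Rightarrow> real" and T \<beta> :: real
    and H \<rho>T Z U :: "complex mat" and \<phi> :: "complex vec" and \<phi>s :: "nat \<Rightarrow> complex vec"
  assumes d: "d \<ge> 1"
    and basis: "orthonormal_basis d b"
    and H: "H = op_sum d (\<lambda>j. complex_of_real (E j) \<cdot>\<^sub>m ket_bra (b j) (b j))"
    and T: "T = 1 / \<beta>" "T > 0"
    and \<rho>T: "\<rho>T = gibbs_state \<beta> H"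
    and Z: "Z = op_sum d (\<lambda>m. exp (2 * complex_of_real pi * \<i> * of_nat m / of_nat d)
                                \<cdot>\<^sub>m ket_bra (b m) (b m))"
    and \<phi>: "\<phi> = complex_of_real (1 / sqrt (real d)) \<cdot>\<^sub>v finsum_vec TYPE(complex) d b {..<d}"
    and \<phi>s: "\<And>j. \<phi>s j = (Z ^\<^sub>m j) *\<^sub>v \<phi>"
    and U: "U = op_sum d (\<lambda>j. ket_bra (\<phi>s j) (b j))"
  shows "(\<forall>V. unitary_op d V \<longrightarrow>
            rel_ent_coherence d b (V * \<rho>T * mat_adjoint V) \<le> log 2 (real d) - vn_entropy \<rho>T) \<and>
         unitary_op d U \<and>
         rel_ent_coherence d b (U * \<rho>T * mat_adjoint U) = log 2 (real d) - vn_entropy \<rho>T \<and>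
         (GREATEST c. \<exists>V. unitary_op d V \<and> c = rel_ent_coherence d b (V * \<rho>T * mat_adjoint V))
            = log 2 (real d) - vn_entropy \<rho>T"
proof -
  let ?B = "col_mat d b" and ?F = "dft_mat d"
  let ?coh = "\<lambda>V. rel_ent_coherence d b (V * \<rho>T * mat_adjoint V)"
  define p where "p j = exp (- \<beta> * E j) / (\<Sum>k<d. exp (- \<beta> * E k))" for j
  have B: "unitary_op d ?B" using unitary_op_col_mat[OF basis] .
  note cB = unitary_op_carrier[OF B]
  have bc: "b j \<in> carrier_vec d" if "j < d" for j using basis that by (simp add: orthonormal_basis_def)
  have ket_bra_sum: "op_sum d (\<lambda>j. c j \<cdot>\<^sub>m ket_bra (b j) (b j)) = spectral_op d ?B c" for c
    by (intro op_sum_smult_ket_bra bc)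
  have \<rho>T_eq: "\<rho>T = spectral_op d ?B (\<lambda>j. complex_of_real (p j))"
    unfolding \<rho>T H ket_bra_sum gibbs_state_spectral_op[OF B] p_def ..
  \<comment> \<open>The partition function; \<open>d \<ge> 1\<close> makes the sum nonempty, so the
    Boltzmann weights \<open>p\<close> are well normalised.\<close>
  have Zs: "(\<Sum>k<d. exp (- \<beta> * E k)) > 0" using d by (intro sum_pos) (auto simp: lessThan_empty_iff)
  have p: "p j \<ge> 0" for j using Zs by (simp add: p_def)
  have sum_p: "(\<Sum>j<d. p j) = 1" using Zs by (simp add: p_def flip: sum_divide_distrib)

  \<comment> \<open>When \<open>X\<close> is the matrix of a unitary \<open>V\<close> in the basis
    \<open>b\<close>, \<open>q X\<close> is the outcome distribution of measuring the evolved
    thermal state in \<open>b\<close>.\<close>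
  define q where "q X j = (\<Sum>k<d. p k * (cmod (X $$ (j, k)))\<^sup>2)" for X :: "complex mat" and j
  \<comment> \<open>The relation \<open>VB\<close> says that \<open>X\<close> represents
    \<open>V\<close> in \<open>b\<close>. The first entropy is that of \<open>q X\<close>; the
    second is unchanged, as the evolved state still has spectrum \<open>p\<close>.\<close>
  have coh: "?coh V = - (\<Sum>j<d. q X j * log 2 (q X j)) - vn_entropy \<rho>T"
    if V: "unitary_op d V" and X: "X \<in> carrier_mat d d" and VB: "V * ?B = ?B * X" for V X
  proof -
    have state: "V * \<rho>T * mat_adjoint V = spectral_op d (?B * X) (\<lambda>j. complex_of_real (p j))"
      using unitary_op_carrier[OF V] by (simp add: \<rho>T_eq spectral_op_conj VB)
    have "unitary_op d (?B * X)" using unitary_op_mult[OF V B] by (simp add: VB)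
    then show ?thesis
      unfolding rel_ent_coherence_def state diag_part_spectral_op[OF basis X] q_def[symmetric]
      by (simp add: vn_entropy_spectral_op[OF B] vn_entropy_spectral_op \<rho>T_eq)
  qed
  have bound: "?coh V \<le> log 2 (real d) - vn_entropy \<rho>T" if V: "unitary_op d V" for V
  proof -
    define X where "X = mat_adjoint ?B * (V * ?B)"
    have X: "unitary_op d X"
      unfolding X_def by (intro unitary_op_mult unitary_op_adjoint B V)
    have "?B * X = (?B * mat_adjoint ?B) * (V * ?B)"
      using cB unitary_op_carrier[OF V]
      by (simp add: X_def assoc_mult_mat[of _ d d _ d _ d] mult_carrier_mat[of _ d d _ d])
    also have "\<dots> = V * ?B"
      using B V unitary_op_carrier[OF V] by (simp add: unitary_op_def)
    finally have VB: "V * ?B = ?B * X" by simp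
    \<comment> \<open>Unit column norms of \<open>X\<close> carry the total mass of \<open>p\<close>
      over to \<open>q X\<close>.\<close>
    have "(\<Sum>j<d. q X j) = (\<Sum>k<d. p k * (\<Sum>j<d. (cmod (X $$ (j, k)))\<^sup>2))"
      unfolding q_def by (subst sum.swap) (simp add: sum_distrib_left)
    also have "\<dots> = 1" by (simp add: unitary_op_col_norm[OF X] sum_p)
    finally have "(\<Sum>j<d. q X j) = 1" .
    moreover have "q X j \<ge> 0" for j unfolding q_def using p by (intro sum_nonneg) auto
    ultimately have "- (\<Sum>j<d. q X j * log 2 (q X j)) \<le> log 2 (real d)"
      by (intro shannon_entropy_le) auto
    then show ?thesis using coh[OF V unitary_op_carrier(1)[OF X] VB] by simp
  qed

  \<comment> \<open>The operator \<open>U\<close> in the coordinates of \<open>b\<close>\<close>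
  define f where "f = vec d (\<lambda>_. complex_of_real (1 / sqrt (real d)))"
  have \<phi>_eq: "\<phi> = ?B *\<^sub>v f"
  proof (rule eq_vecI)
    have fs: "finsum_vec TYPE(complex) d b {..<d} \<in> carrier_vec d"
      using bc by (intro finsum_vec_closed) auto
    fix i assume "i < dim_vec (?B *\<^sub>v f)"
    then have i: "i < d" by (simp add: col_mat_def)
    then have "finsum_vec TYPE(complex) d b {..<d} $ i = (\<Sum>j<d. b j $ i)"
      using bc by (intro index_finsum_vec) auto
    then show "\<phi> $ i = (?B *\<^sub>v f) $ i"
      using i fs by (simp add: \<phi> f_def col_mat_def scalar_prod_def atLeast0LessThan sum_divide_distrib)
  next
    show "dim_vec \<phi> = dim_vec (?B *\<^sub>v f)"
      using bc finsum_vec_closed[of b "{..<d}" d] by (auto simp: \<phi> col_mat_def Pi_def)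
  qed
  \<comment> \<open>In \<open>b\<close>-coordinates \<open>Z\<close> is diagonal and
    \<open>\<phi>\<close> is the constant vector \<open>f\<close>, so \<open>Z ^\<^sub>m j\<close>
    turns \<open>f\<close> into column \<open>j\<close> of the Fourier matrix.\<close>
  have \<phi>s_eq: "\<phi>s j = col (?B * ?F) j" if j: "j < d" for j
  proof -
    let ?D = "mat_diag d (\<lambda>m. exp (2 * complex_of_real pi * \<i> * of_nat m / of_nat d) ^ j)"
    have f: "f \<in> carrier_vec d" by (simp add: f_def)
    have "\<phi>s j = (?B * ?D * mat_adjoint ?B) *\<^sub>v (?B *\<^sub>v f)"
      unfolding \<phi>s Z ket_bra_sum spectral_op_pow[OF B] \<phi>_eq
      by (simp add: spectral_op_def)
    also have "\<dots> = (?B * ?D * (mat_adjoint ?B * ?B)) *\<^sub>v f"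
      using cB f mat_diag_dim[of d]
      by (simp add: assoc_mult_mat[of _ d d _ d _ d] mult_carrier_mat[of _ d d _ d]
          flip: assoc_mult_mat_vec[of _ d d _ d])
    also have "\<dots> = ?B *\<^sub>v (?D *\<^sub>v f)"
      using B f by (simp add: unitary_op_def assoc_mult_mat_vec[of _ d d _ d]
          right_mult_one_mat[of _ d d] mult_carrier_mat[of _ d d])
    also have "?D *\<^sub>v f = col ?F j"
    proof (rule eq_vecI)
      fix i assume "i < dim_vec (col ?F j)"
      then have i: "i < d" by (simp add: dft_mat_def)
      \<comment> \<open>The vector is viewed as a one-column matrix so that
        \<open>mat_diag_mult_left\<close> applies.\<close>
      have "?D *\<^sub>v f = col (?D * mat d 1 (\<lambda>(i, _). f $ i)) 0"
        by (intro eq_vecI) (auto simp: mat_diag_def f_def col_def scalar_prod_def)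
      then show "(?D *\<^sub>v f) $ i = col ?F j $ i"
        using i j by (simp add: mat_diag_mult_left[of _ d 1] f_def dft_mat_def)
    qed (simp add: mat_diag_def dft_mat_def)
    also have "?B *\<^sub>v col ?F j = col (?B * ?F) j"
      using j by (intro col_mult2[symmetric, of _ d d _ d]) auto
    finally show ?thesis .
  qed
  have BF: "?B * ?F \<in> carrier_mat d d" by (simp add: mult_carrier_mat[of _ d d _ d])
  have "col_mat d \<phi>s = ?B * ?F"
    using BF carrier_matD[OF col_mat_carrier] carrier_matD[OF dft_mat_carrier]
    by (intro eq_matI) (auto simp: col_mat_def[of d \<phi>s] \<phi>s_eq)
  moreover have "\<phi>s j \<in> carrier_vec d" if "j < d" for j
    using that carrier_matD[OF BF] by (simp add: \<phi>s_eq carrier_dim_vec del: index_mult_mat)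
  ultimately have U_eq: "U = ?B * ?F * mat_adjoint ?B"
    using bc by (simp add: U op_sum_ket_bra)
  have uU: "unitary_op d U"
    unfolding U_eq by (intro unitary_op_mult unitary_op_adjoint B unitary_op_dft_mat)
  have "U * ?B = ?B * ?F * (mat_adjoint ?B * ?B)"
    using cB by (simp add: U_eq assoc_mult_mat[of _ d d _ d _ d] mult_carrier_mat[of _ d d _ d])
  also have "\<dots> = ?B * ?F" using B BF by (simp add: unitary_op_def right_mult_one_mat[of _ d d])
  finally have UB: "U * ?B = ?B * ?F" .
  \<comment> \<open>All entries of \<open>?F\<close> have squared modulus \<open>1 / real d\<close>,
    so averaging \<open>p\<close> gives the uniform distribution at every temperature.\<close>
  have "q ?F j = 1 / real d" if "j < d" for j
    using that sum_p by (simp add: q_def cmod_dft_mat flip: sum_divide_distrib)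
  then have "- (\<Sum>j<d. q ?F j * log 2 (q ?F j)) = log 2 (real d)"
    using d by (simp add: log_divide)
  then have attained: "?coh U = log 2 (real d) - vn_entropy \<rho>T"
    using coh[OF uU _ UB] by simp
  \<comment> \<open>\<open>U\<close> attains the value and \<open>bound\<close> makes it an upper
    bound, so \<open>GREATEST\<close> denotes a genuine maximum.\<close>
  have "(GREATEST c. \<exists>V. unitary_op d V \<and> c = ?coh V) = log 2 (real d) - vn_entropy \<rho>T"
    by (rule Greatest_equality) (use uU attained bound in \<open>auto intro: exI[of _ U]\<close>)
  then show ?thesis using bound uU attained by blast
qed

end
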